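(* For every $t\in(-\pi,\pi)$, $$\int_0^1 \ln(-\ln x)\,\frac{1}{1+2x\cos t+x^2}\,dx = \frac{\pi}{2\sin t}\,\ln\frac{(2\pi)^{t/\pi}\,\Gamma\left(\frac12+\frac{t}{2\pi}\right)}{\Gamma\left(\frac12-\frac{t}{2\pi}\right)},$$ where for $t=0$ the right-hand side is understood as its limit as $t\to 0$.
   Context: $\Gamma$ denotes the gamma function. *)

theory Defs
  imports "HOL-Analysis.Analysis"
begin

definition log_log_integrand :: "real \<Rightarrow> real \<Rightarrow> real" where
  "log_log_integrand t x = ln (- ln x) * (1 / (1 + 2 * x * cos t + x\<^sup>2))"

text \<open>
  The closed form is meaningful for \<open>0 < \<bar>t\<bar> < \<pi>\<close>, where \<open>sin t \<noteq> 0\<close>. At \<open>t = 0\<close> this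
  function takes the value 0 since division by 0 gives 0; that value is not the intended one,
  which is the limit as \<open>t \<longlongrightarrow> 0\<close>.
\<close>

definition log_log_closed_form :: "real \<Rightarrow> real" where
  "log_log_closed_form t =
     pi / (2 * sin t) *
     ln ((2 * pi) powr (t / pi) * Gamma (1 / 2 + t / (2 * pi)) / Gamma (1 / 2 - t / (2 * pi)))"

end

theory Submission
  imports Defs "HOL-Real_Asymp.Real_Asymp"
begin

text \<open>
  With \<open>x = exp (- u)\<close> the integral becomes \<open>1 / (2 sin t)\<close> times the integral over \<open>u > 0\<close> of
  \<open>ln u\<close> against the kernel \<open>K u = sin t / (cosh u + cos t)\<close>, and one may assume \<open>0 < t < \<pi>\<close>
  (\<open>t < 0\<close> follows by symmetry, \<open>t = 0\<close> by dominated convergence). The partial fraction expansion of the tangent writes \<open>K\<close> as the sum over \<open>k\<close> of differences of Poisson kernels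
  \<open>2 (c / (c\<^sup>2 + u\<^sup>2))\<close> at \<open>c = (2k + 1) \<pi> - t\<close> and \<open>c = (2k + 1) \<pi> + t\<close>. It cannot be integrated termwise
  against \<open>ln u\<close>: mass \<open>t\<close> escapes to infinity and the resulting series diverges. So \<open>ln u\<close> is first replaced by
  \<open>- ln (1 + A\<^sup>2 / u\<^sup>2) / 2\<close>, which is integrable and whose integral against a Poisson kernel is a multiple of
  \<open>ln c - ln (c + A)\<close>. For \<open>A = 2 \<pi> n\<close> the shift \<open>c + A\<close> is a shift of \<open>k\<close> by \<open>n\<close>, so the
  series telescopes to a sum of \<open>n\<close> terms. Since \<open>K\<close> has integral \<open>t\<close>, adding back \<open>t ln A\<close> and
  letting \<open>n\<close> tend to infinity gives Gauss's product for the quotient of the two Gamma values.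
\<close>

section \<open>Partial fractions of the tangent and of the kernel\<close>

text \<open>Logarithmic derivative of the reflection formula
  \<open>Gamma z * Gamma (1 - z) = pi / sin (pi * z)\<close>. For non-integral \<open>z\<close> both
  Gamma factors are regular and non-zero, so the product cancels.\<close>

lemma Digamma_reflection_complex:
  fixes z :: complex
  assumes "z \<notin> \<int>"
  shows "Digamma (1 - z) - Digamma z = of_real pi * cot (of_real pi * z)"
proof -
  have z: "z \<notin> \<int>\<^sub>\<le>\<^sub>0" "1 - z \<notin> \<int>\<^sub>\<le>\<^sub>0"
    using assms nonpos_Ints_subset_Ints Ints_diff[of 1 "1 - z"] by auto
  have s: "sin (of_real pi * z) \<noteq> 0"
    using assms by (auto simp: sin_eq_0 mult.commute)
  have ne: "Gamma z * Gamma (1 - z) \<noteq> 0"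
    using z by (simp add: Gamma_eq_zero_iff)
  have "((\<lambda>z. Gamma z * Gamma (1 - z)) has_field_derivative
          Gamma z * Gamma (1 - z) * (Digamma z - Digamma (1 - z))) (at z)"
    using z by (auto intro!: derivative_eq_intros simp: algebra_simps)
  moreover have "((\<lambda>z. Gamma z * Gamma (1 - z)) has_field_derivative
          - (of_real pi / sin (of_real pi * z)) * (of_real pi * cot (of_real pi * z))) (at z)"
    unfolding Gamma_reflection_complex
    using s by (auto intro!: derivative_eq_intros simp: cot_def field_simps power2_eq_square)
  ultimately have "Gamma z * Gamma (1 - z) * (Digamma z - Digamma (1 - z)) =
      Gamma z * Gamma (1 - z) * (- (of_real pi * cot (of_real pi * z)))"
    by (auto dest: DERIV_unique simp: Gamma_reflection_complex)
  then show ?thesis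
    using ne by (metis mult_cancel_left minus_diff_eq minus_minus)
qed

text \<open>In the limit formula for \<open>Digamma\<close> the terms \<open>ln m\<close> cancel in
  the difference at \<open>1 - z\<close> and \<open>z\<close>, leaving a series of reciprocals. The
  choice \<open>z = 1 / 2 - w\<close> turns the cotangent of the reflection formula into a
  tangent.\<close>

lemma sums_tan_partial_fractions:
  fixes w :: complex
  assumes "w + 1 / 2 \<notin> \<int>"
  shows "(\<lambda>k. 1 / (of_nat k + 1 / 2 - w) - 1 / (of_nat k + 1 / 2 + w)) sums (of_real pi * tan (of_real pi * w))"
proof -
  define z where "z = 1 / 2 - w"
  have z: "z \<notin> \<int>" and z': "1 - z = 1 / 2 + w"
    using assms Ints_diff[of 1 z] by (auto simp: z_def algebra_simps)
  have "z \<noteq> 0" "1 - z \<noteq> 0"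
    using z by auto
  then have "(\<lambda>m. (of_real (ln (real m)) - (\<Sum>n<m. inverse (1 - z + of_nat n))) -
      (of_real (ln (real m)) - (\<Sum>n<m. inverse (z + of_nat n)))) \<longlonglongrightarrow> Digamma (1 - z) - Digamma z"
    by (intro tendsto_diff Digamma_LIMSEQ)
  then have "(\<lambda>n. inverse (z + of_nat n) - inverse (1 - z + of_nat n)) sums (Digamma (1 - z) - Digamma z)"
    by (simp add: sums_def sum_subtractf)
  moreover have "cot (of_real pi * z) = tan (of_real pi * w)"
    by (simp add: z_def algebra_simps cot_def tan_def sin_diff cos_diff flip: sin_of_real cos_of_real)
  ultimately show ?thesis
    by (simp add: Digamma_reflection_complex[OF z]) (simp add: z_def field_simps)
qed

text \<open>Twice the real part is \<open>tan z + tan (cnj z)\<close>. The addition formula and the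
  product formula for cosines leave only \<open>z + cnj z\<close>, which is real, and
  \<open>z - cnj z\<close>, which is imaginary and turns \<open>cos\<close> into
  \<open>cosh\<close>.\<close>

lemma Re_tan: "Re (tan z) = sin (2 * Re z) / (cosh (2 * Im z) + cos (2 * Re z))"
proof (cases "cos z = 0")
  \<comment> \<open>At a zero of \<open>cos\<close> the left side is 0 through division by zero. The
    right side vanishes too: \<open>cos (Re z) = 0\<close> makes \<open>sin (2 * Re z)\<close>
    zero.\<close>
  case True
  then have c: "Re (cos z) = 0" "Im (cos z) = 0" by simp_all
  have ep: "exp (Im z) + exp (- Im z) \<noteq> 0" by (smt (verit) exp_gt_zero)
  have "cos (Re z) = 0" using c ep by (simp add: Re_cos)
  then show ?thesis using True by (simp add: tan_def sin_double)
next
  case False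
  have cosh_cr: "cosh (complex_of_real y) = of_real (cosh y)" for y
    by (simp add: cosh_field_def flip: exp_of_real)
  have "complex_of_real (2 * Re (tan z)) = tan z + tan (cnj z)"
    by (subst complex_add_cnj[symmetric]) (simp add: tan_def cnj_sin cnj_cos)
  also have "\<dots> = sin (z + cnj z) / (cos z * cos (cnj z))"
    using False by (intro add_tan_eq) (auto simp flip: cnj_cos)
  also have "cos z * cos (cnj z) = (cos (z - cnj z) + cos (z + cnj z)) / 2"
    by (simp add: cos_times_cos)
  also have "z + cnj z = of_real (2 * Re z)" by (simp add: complex_add_cnj)
  also have "z - cnj z = \<i> * of_real (2 * Im z)" by (simp add: complex_diff_cnj)
  also have "cos \<dots> = cosh (of_real (2 * Im z))" by (simp only: cosh_conv_cos)
  also have "\<dots> = of_real (cosh (2 * Im z))" by (rule cosh_cr)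
  finally have "complex_of_real (2 * Re (tan z)) = of_real (2 * (sin (2 * Re z) / (cosh (2 * Im z) + cos (2 * Re z))))"
    by (simp only: sin_of_real cos_of_real) simp
  then have "2 * Re (tan z) = 2 * (sin (2 * Re z) / (cosh (2 * Im z) + cos (2 * Re z)))"
    by (simp only: of_real_eq_iff)
  then show ?thesis by simp
qed

lemma Re_inverse_scaled: "Re (1 / Complex (x / (2 * pi)) (y / (2 * pi))) = pi * (2 * (x / (x\<^sup>2 + y\<^sup>2)))"
proof -
  have "1 / Complex (x / (2 * pi)) (y / (2 * pi)) = of_real (2 * pi) / Complex x y"
    by (simp add: Complex_eq field_simps)
  then show ?thesis
    by (simp only: Re_divide) simp
qed

text \<open>Real part of the tangent expansion at \<open>w = (t + \<i> u) / (2 pi)\<close>: the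
  factor \<open>2 pi\<close> makes \<open>Re_tan\<close> produce exactly \<open>t\<close> and
  \<open>u\<close>, and each reciprocal has a Poisson kernel as its real part. The bounds on
  \<open>t\<close> put \<open>Re (w + 1 / 2)\<close> strictly between 0 and 1, away from the
  poles.\<close>

lemma sums_kernel_partial_fractions:
  fixes t u :: real
  assumes "0 < t" "t < pi"
  defines "a \<equiv> \<lambda>k. (2 * real k + 1) * pi"
  shows "(\<lambda>k. 2 * ((a k - t) / ((a k - t)\<^sup>2 + u\<^sup>2) - (a k + t) / ((a k + t)\<^sup>2 + u\<^sup>2))) sums
    (sin t / (cosh u + cos t))"
proof -
  define w where "w = Complex (t / (2 * pi)) (u / (2 * pi))"
  have Re: "0 < Re (w + 1 / 2)" "Re (w + 1 / 2) < 1"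
    using assms by (auto simp: w_def field_simps)
  have "w + 1 / 2 \<notin> \<int>"
  proof
    assume "w + 1 / 2 \<in> \<int>"
    then obtain n where "w + 1 / 2 = of_int n" by (auto elim: Ints_cases)
    with Re show False by simp
  qed
  from sums_Re[OF sums_tan_partial_fractions[OF this]]
  have S: "(\<lambda>k. Re (1 / (of_nat k + 1 / 2 - w)) - Re (1 / (of_nat k + 1 / 2 + w))) sums
      (pi * (sin t / (cosh u + cos t)))"
    by (simp add: Re_tan) (simp add: w_def)
  have e1: "Re (1 / (of_nat k + 1 / 2 - w)) = pi * (2 * ((a k - t) / ((a k - t)\<^sup>2 + u\<^sup>2)))" for k
  proof -
    have "of_nat k + 1 / 2 - w = Complex ((a k - t) / (2 * pi)) (- u / (2 * pi))"
      by (simp add: complex_eq_iff w_def a_def field_simps)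
    then show ?thesis
      by (simp only: Re_inverse_scaled) simp
  qed
  have e2: "Re (1 / (of_nat k + 1 / 2 + w)) = pi * (2 * ((a k + t) / ((a k + t)\<^sup>2 + u\<^sup>2)))" for k
  proof -
    have "of_nat k + 1 / 2 + w = Complex ((a k + t) / (2 * pi)) (u / (2 * pi))"
      by (simp add: complex_eq_iff w_def a_def field_simps)
    then show ?thesis
      by (simp only: Re_inverse_scaled)
  qed
  from S have "(\<lambda>k. pi * (2 * ((a k - t) / ((a k - t)\<^sup>2 + u\<^sup>2) - (a k + t) / ((a k + t)\<^sup>2 + u\<^sup>2)))) sums
      (pi * (sin t / (cosh u + cos t)))"
    unfolding e1 e2 right_diff_distrib .
  then show ?thesis
    by (subst (asm) sums_mult_iff) auto
qed

section \<open>The logarithmic gap and its integrals against Poisson kernels\<close>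

text \<open>For \<open>u > 0\<close> this is the logarithm of
  \<open>sqrt (u\<^sup>2 + A\<^sup>2)\<close> minus \<open>ln u\<close>: it carries the singularity
  of \<open>- ln u\<close> at 0, but decays like \<open>1 / u\<^sup>2\<close> at infinity.\<close>

definition log_gap :: "real \<Rightarrow> real \<Rightarrow> real" where
  "log_gap A u = ln (1 + A\<^sup>2 / u\<^sup>2) / 2"

lemma borel_measurable_log_gap [measurable]: "log_gap A \<in> borel_measurable borel"
  unfolding log_gap_def by measurable

lemma log_gap_nonneg: "0 \<le> log_gap A u"
  by (simp add: log_gap_def)

lemma nn_integral_lborel_cong_except:
  fixes f g :: "real \<Rightarrow> ennreal"
  assumes "\<And>x. x \<noteq> a \<Longrightarrow> f x = g x"
  shows "integral\<^sup>N lborel f = integral\<^sup>N lborel g"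
  using AE_lborel_singleton[of a] assms by (intro nn_integral_cong_AE) (auto elim: eventually_mono)

lemma nn_integral_Poisson:
  fixes a :: real
  assumes "0 < a"
  shows "(\<integral>\<^sup>+u. ennreal (a / (u\<^sup>2 + a\<^sup>2)) * indicator {0<..} u \<partial>lborel) = ennreal (pi / 2)"
proof -
  have "(\<integral>\<^sup>+u. ennreal (a / (u\<^sup>2 + a\<^sup>2)) * indicator {0<..} u \<partial>lborel) =
      (\<integral>\<^sup>+u. ennreal (a / (u\<^sup>2 + a\<^sup>2)) * indicator {0..} u \<partial>lborel)"
    by (intro nn_integral_lborel_cong_except[of 0]) (auto split: split_indicator)
  also have "\<dots> = ennreal (pi / 2 - arctan (0 / a))"
  proof (rule nn_integral_FTC_atLeast)
    show "((\<lambda>u. arctan (u / a)) has_real_derivative a / (u\<^sup>2 + a\<^sup>2)) (at u)" for u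
      using assms by (auto intro!: derivative_eq_intros simp: field_simps power2_eq_square)
    show "((\<lambda>u. arctan (u / a)) \<longlongrightarrow> pi / 2) at_top"
      using assms by real_asymp
  qed (use assms in auto)
  finally show ?thesis by simp
qed

text \<open>Partial fractions in \<open>u\<^sup>2\<close> give an antiderivative made of two
  arctangents over \<open>a\<^sup>2 - c\<^sup>2\<close>, whence the condition
  \<open>a \<noteq> c\<close>. The excluded \<open>a\<close> will form a null set when
  \<open>a\<close> becomes an integration variable.\<close>

lemma nn_integral_Poisson_mult:
  fixes a c :: real
  assumes "0 < a" "0 < c" "a \<noteq> c"
  shows "(\<integral>\<^sup>+u. ennreal (a / (u\<^sup>2 + a\<^sup>2)) * ennreal (c / (u\<^sup>2 + c\<^sup>2)) * indicator {0<..} u \<partial>lborel) =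
    ennreal (pi / 2 / (a + c))"
proof -
  have "(\<integral>\<^sup>+u. ennreal (a / (u\<^sup>2 + a\<^sup>2)) * ennreal (c / (u\<^sup>2 + c\<^sup>2)) * indicator {0<..} u \<partial>lborel) =
      (\<integral>\<^sup>+u. ennreal (a / (u\<^sup>2 + a\<^sup>2) * (c / (u\<^sup>2 + c\<^sup>2))) * indicator {0..} u \<partial>lborel)"
    using assms
    by (intro nn_integral_lborel_cong_except[of 0])
      (auto split: split_indicator simp flip: ennreal_mult)
  also have "\<dots> = ennreal (pi / 2 / (a + c) - (a * arctan (0 / c) - c * arctan (0 / a)) / (a\<^sup>2 - c\<^sup>2))"
  proof (rule nn_integral_FTC_atLeast)
    have ne: "a\<^sup>2 - c\<^sup>2 \<noteq> 0" "u\<^sup>2 + a\<^sup>2 \<noteq> 0" "u\<^sup>2 + c\<^sup>2 \<noteq> 0" for u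
      using assms by (auto simp: sum_power2_eq_zero_iff)
    have "((\<lambda>u. arctan (u / d)) has_real_derivative d / (u\<^sup>2 + d\<^sup>2)) (at u)" if "0 < d" for d u :: real
      using that by (auto intro!: derivative_eq_intros simp: field_simps power2_eq_square)
    then have "((\<lambda>u. (a * arctan (u / c) - c * arctan (u / a)) / (a\<^sup>2 - c\<^sup>2)) has_real_derivative
        (a * (c / (u\<^sup>2 + c\<^sup>2)) - c * (a / (u\<^sup>2 + a\<^sup>2))) / (a\<^sup>2 - c\<^sup>2)) (at u)" for u
      using assms by (intro DERIV_cdivide DERIV_diff DERIV_cmult) auto
    moreover have "(a * (c / (u\<^sup>2 + c\<^sup>2)) - c * (a / (u\<^sup>2 + a\<^sup>2))) / (a\<^sup>2 - c\<^sup>2) =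
        a / (u\<^sup>2 + a\<^sup>2) * (c / (u\<^sup>2 + c\<^sup>2))" for u
      using ne(1) ne(2,3)[of u] by (simp add: divide_simps) algebra
    ultimately show "((\<lambda>u. (a * arctan (u / c) - c * arctan (u / a)) / (a\<^sup>2 - c\<^sup>2)) has_real_derivative
        a / (u\<^sup>2 + a\<^sup>2) * (c / (u\<^sup>2 + c\<^sup>2))) (at u)" for u
      by simp
    have "((\<lambda>u. arctan (u / d)) \<longlongrightarrow> pi / 2) at_top" if "0 < d" for d :: real
      using that by real_asymp
    then have "((\<lambda>u. (a * arctan (u / c) - c * arctan (u / a)) / (a\<^sup>2 - c\<^sup>2)) \<longlongrightarrow>
        (a * (pi / 2) - c * (pi / 2)) / (a\<^sup>2 - c\<^sup>2)) at_top"
      using assms ne by (intro tendsto_intros) auto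
    moreover have "(a * (pi / 2) - c * (pi / 2)) / (a\<^sup>2 - c\<^sup>2) = pi / 2 / (a + c)"
    proof -
      have e: "a\<^sup>2 - c\<^sup>2 = (a - c) * (a + c)" "a * (pi / 2) - c * (pi / 2) = (a - c) * (pi / 2)"
        by algebra+
      show ?thesis
        unfolding e using assms by (subst mult_divide_mult_cancel_left) auto
    qed
    ultimately show "((\<lambda>u. (a * arctan (u / c) - c * arctan (u / a)) / (a\<^sup>2 - c\<^sup>2)) \<longlongrightarrow> pi / 2 / (a + c)) at_top"
      by simp
  qed (use assms in auto)
  finally show ?thesis by simp
qed

text \<open>The gap is itself the integral of the Poisson kernels
  \<open>a / (u\<^sup>2 + a\<^sup>2)\<close> over \<open>a\<close> from 0 to \<open>A\<close>, and
  for non-negative integrands the two integrations may be exchanged freely. The weight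
  \<open>w\<close> will be 1 or another Poisson kernel.\<close>

lemma nn_integral_log_gap_mult:
  fixes w :: "real \<Rightarrow> ennreal"
  assumes [measurable]: "w \<in> borel_measurable borel" and A: "0 \<le> A"
  shows "(\<integral>\<^sup>+u. ennreal (log_gap A u) * w u * indicator {0<..} u \<partial>lborel) =
    (\<integral>\<^sup>+a. (\<integral>\<^sup>+u. ennreal (a / (u\<^sup>2 + a\<^sup>2)) * w u * indicator {0<..} u \<partial>lborel) * indicator {0..A} a \<partial>lborel)"
proof -
  have FTC: "(\<integral>\<^sup>+a. ennreal (a / (u\<^sup>2 + a\<^sup>2)) * indicator {0..A} a \<partial>lborel) = ennreal (log_gap A u)" if "0 < u" for u :: real
  proof -
    have p: "0 < u\<^sup>2 + a\<^sup>2" for a using that by (simp add: add_pos_nonneg)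
    have "(\<integral>\<^sup>+a. ennreal (a / (u\<^sup>2 + a\<^sup>2)) * indicator {0..A} a \<partial>lborel) =
        ennreal (ln (u\<^sup>2 + A\<^sup>2) / 2 - ln (u\<^sup>2 + 0\<^sup>2) / 2)"
    proof (rule nn_integral_FTC_Icc)
      show "((\<lambda>a. ln (u\<^sup>2 + a\<^sup>2) / 2) has_real_derivative a / (u\<^sup>2 + a\<^sup>2)) (at a)" for a
      proof -
        have "((\<lambda>a. ln (u\<^sup>2 + a\<^sup>2) / 2) has_real_derivative (1 / (u\<^sup>2 + a\<^sup>2) * (2 * a)) / 2) (at a)"
          using p[of a] by (intro DERIV_cdivide DERIV_chain2[OF DERIV_ln_divide]) (auto intro!: derivative_eq_intros)
        moreover have "(1 / x * (2 * a)) / 2 = a / x" for x :: real by simp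
        ultimately show ?thesis by (simp only:)
      qed
    qed (use A p in \<open>auto intro: less_imp_le\<close>)
    also have "ln (u\<^sup>2 + A\<^sup>2) / 2 - ln (u\<^sup>2 + 0\<^sup>2) / 2 = ln ((u\<^sup>2 + A\<^sup>2) / u\<^sup>2) / 2"
      using that p[of A] by (simp add: ln_div field_simps)
    also have "(u\<^sup>2 + A\<^sup>2) / u\<^sup>2 = 1 + A\<^sup>2 / u\<^sup>2"
      using that by (simp add: field_simps)
    finally show ?thesis by (simp add: log_gap_def)
  qed
  have "(\<integral>\<^sup>+u. ennreal (log_gap A u) * w u * indicator {0<..} u \<partial>lborel) =
      (\<integral>\<^sup>+u. (\<integral>\<^sup>+a. ennreal (a / (u\<^sup>2 + a\<^sup>2)) * indicator {0..A} a * (w u * indicator {0<..} u) \<partial>lborel) \<partial>lborel)"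
    by (intro nn_integral_cong, subst nn_integral_multc)
      (auto split: split_indicator simp: FTC mult.assoc)
  also have "\<dots> = (\<integral>\<^sup>+a. (\<integral>\<^sup>+u. ennreal (a / (u\<^sup>2 + a\<^sup>2)) * indicator {0..A} a * (w u * indicator {0<..} u) \<partial>lborel) \<partial>lborel)"
    by (intro lborel_pair.Fubini') measurable
  also have "\<dots> = (\<integral>\<^sup>+a. (\<integral>\<^sup>+u. (ennreal (a / (u\<^sup>2 + a\<^sup>2)) * w u * indicator {0<..} u) * indicator {0..A} a \<partial>lborel) \<partial>lborel)"
    by (simp add: mult_ac)
  also have "\<dots> = (\<integral>\<^sup>+a. (\<integral>\<^sup>+u. ennreal (a / (u\<^sup>2 + a\<^sup>2)) * w u * indicator {0<..} u \<partial>lborel) * indicator {0..A} a \<partial>lborel)"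
    by (intro nn_integral_cong nn_integral_multc) measurable
  finally show ?thesis .
qed

lemma has_bochner_integral_log_gap:
  assumes "0 \<le> A"
  shows "has_bochner_integral lborel (\<lambda>u. indicator {0<..} u * log_gap A u) (pi / 2 * A)"
proof (rule has_bochner_integral_nn_integral)
  have "(\<integral>\<^sup>+u. ennreal (indicator {0<..} u * log_gap A u) \<partial>lborel) =
      (\<integral>\<^sup>+u. ennreal (log_gap A u) * 1 * indicator {0<..} u \<partial>lborel)"
    by (intro nn_integral_cong) (auto split: split_indicator)
  also have "\<dots> = (\<integral>\<^sup>+a. (\<integral>\<^sup>+u. ennreal (a / (u\<^sup>2 + a\<^sup>2)) * 1 * indicator {0<..} u \<partial>lborel) * indicator {0..A} a \<partial>lborel)"
    by (rule nn_integral_log_gap_mult) (use assms in auto)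
  \<comment> \<open>At \<open>a = 0\<close> the inner integral is 0 instead of
    \<open>pi / 2\<close>, hence the exceptional point.\<close>
  also have "\<dots> = (\<integral>\<^sup>+a. ennreal (pi / 2) * indicator {0..A} a \<partial>lborel)"
    by (intro nn_integral_lborel_cong_except[of 0])
      (auto split: split_indicator simp: nn_integral_Poisson)
  also have "\<dots> = ennreal (pi / 2 * A)"
    using assms by (simp add: nn_integral_cmult_indicator flip: ennreal_mult)
  finally show "(\<integral>\<^sup>+u. ennreal (indicator {0<..} u * log_gap A u) \<partial>lborel) = ennreal (pi / 2 * A)" .
qed (use assms in \<open>auto simp: log_gap_nonneg\<close>)

text \<open>Two Poisson kernels integrate to \<open>pi / 2 / (a + c)\<close>, whose integral over
  \<open>a\<close> is a logarithm. In the result \<open>A\<close> only acts by translating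
  \<open>c\<close>, and this is what later makes the series telescope.\<close>

lemma has_bochner_integral_log_gap_Poisson:
  assumes "0 \<le> A" "0 < c"
  shows "has_bochner_integral lborel (\<lambda>u. indicator {0<..} u * (log_gap A u * (c / (u\<^sup>2 + c\<^sup>2))))
    (pi / 2 * (ln (c + A) - ln c))"
proof (rule has_bochner_integral_nn_integral)
  have "(\<integral>\<^sup>+u. ennreal (indicator {0<..} u * (log_gap A u * (c / (u\<^sup>2 + c\<^sup>2)))) \<partial>lborel) =
      (\<integral>\<^sup>+u. ennreal (log_gap A u) * ennreal (c / (u\<^sup>2 + c\<^sup>2)) * indicator {0<..} u \<partial>lborel)"
    using assms
    by (intro nn_integral_cong) (auto split: split_indicator simp: log_gap_nonneg simp flip: ennreal_mult)
  also have "\<dots> = (\<integral>\<^sup>+a. (\<integral>\<^sup>+u. ennreal (a / (u\<^sup>2 + a\<^sup>2)) * ennreal (c / (u\<^sup>2 + c\<^sup>2)) * indicator {0<..} u \<partial>lborel) * indicator {0..A} a \<partial>lborel)"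
    by (rule nn_integral_log_gap_mult) (use assms in auto)
  also have "\<dots> = (\<integral>\<^sup>+a. ennreal (pi / 2 / (a + c)) * indicator {0..A} a \<partial>lborel)"
  \<comment> \<open>The points \<open>a = 0\<close> and \<open>a = c\<close>, where
    \<open>nn_integral_Poisson_mult\<close> does not apply, are discarded as null sets.\<close>
  proof (rule nn_integral_cong_AE)
    show "AE a in lborel. (\<integral>\<^sup>+u. ennreal (a / (u\<^sup>2 + a\<^sup>2)) * ennreal (c / (u\<^sup>2 + c\<^sup>2)) * indicator {0<..} u \<partial>lborel) *
        indicator {0..A} a = ennreal (pi / 2 / (a + c)) * indicator {0..A} a"
      using AE_lborel_singleton[of 0] AE_lborel_singleton[of c]
      by eventually_elim (use assms in \<open>auto split: split_indicator simp: nn_integral_Poisson_mult\<close>)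
  qed
  also have "\<dots> = ennreal (pi / 2 * ln (A + c) - pi / 2 * ln (0 + c))"
  proof (rule nn_integral_FTC_Icc[where F = "\<lambda>a. pi / 2 * ln (a + c)"])
    show "((\<lambda>a. pi / 2 * ln (a + c)) has_real_derivative pi / 2 / (a + c)) (at a)" if "a \<in> {0..A}" for a
    proof -
      have "((\<lambda>a. pi / 2 * ln (a + c)) has_real_derivative pi / 2 * (1 / (a + c) * 1)) (at a)"
        using that assms by (intro DERIV_cmult DERIV_chain2[OF DERIV_ln_divide]) (auto intro!: derivative_eq_intros)
      then show ?thesis by simp
    qed
  qed (use assms in auto)
  also have "pi / 2 * ln (A + c) - pi / 2 * ln (0 + c) = pi / 2 * (ln (c + A) - ln c)"
    by (simp add: right_diff_distrib add.commute)
  finally show "(\<integral>\<^sup>+u. ennreal (indicator {0<..} u * (log_gap A u * (c / (u\<^sup>2 + c\<^sup>2)))) \<partial>lborel) =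
      ennreal (pi / 2 * (ln (c + A) - ln c))"
    .
qed (use assms in \<open>auto simp: log_gap_nonneg\<close>)

section \<open>Bounds, integrability and total mass of the kernel\<close>

text \<open>Exponential decay of the kernel. The sum \<open>cosh u + c\<close> splits into
  \<open>(1 + c) / 2 * (cosh u + 1)\<close>, which dominates the exponential, and
  \<open>(1 - c) / 2 * (cosh u - 1)\<close>, which is non-negative.\<close>

lemma cosh_add_ge:
  fixes u c :: real
  assumes "-1 < c" "c \<le> 1"
  shows "(1 + c) / 4 * exp u \<le> cosh u + c"
proof -
  have "(1 + c) / 4 * exp u \<le> (1 + c) / 2 * cosh u"
    using assms mult_left_mono[of "exp u" "2 * cosh u" "(1 + c) / 4"] by (simp add: cosh_field_def)
  moreover have "0 \<le> (1 - c) / 2 * (cosh u - 1)"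
    using assms cosh_real_ge_1[of u] by simp
  ultimately show ?thesis
    using assms by (simp add: field_simps)
qed

lemma borel_measurable_cosh [measurable]: "(cosh :: real \<Rightarrow> real) \<in> borel_measurable borel"
  by (intro borel_measurable_continuous_onI continuous_intros)

lemma cosh_add_pos:
  fixes u c :: real
  assumes "-1 < c"
  shows "0 < cosh u + c"
  using assms cosh_real_ge_1[of u] by linarith

lemma cos_gt_minus_one:
  fixes t :: real
  assumes "\<bar>t\<bar> < pi"
  shows "-1 < cos t"
  using assms cos_monotone_0_pi[of "\<bar>t\<bar>" pi] by simp

lemma ln_one_plus_square_le:
  fixes u :: real
  assumes "0 \<le> u"
  shows "ln (1 + u\<^sup>2) / 2 \<le> u"
proof -
  have "ln (1 + u\<^sup>2) \<le> ln ((1 + u)\<^sup>2)"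
    using assms by (intro ln_mono) (auto simp: power2_eq_square algebra_simps add_pos_nonneg)
  also have "\<dots> = 2 * ln (1 + u)"
    using assms by (simp add: ln_realpow)
  also have "\<dots> \<le> 2 * u"
    using assms ln_add_one_self_le_self[of u] by simp
  finally show ?thesis by simp
qed

text \<open>The decomposition behind the main computation. Against the kernel, the constant
  \<open>ln A\<close> meets its total mass, the middle term vanishes as \<open>A\<close> grows, and
  the gap can be integrated termwise.\<close>

lemma ln_eq_log_gap:
  assumes "0 < A" "0 < u"
  shows "ln u = ln A + ln (1 + (u / A)\<^sup>2) / 2 - log_gap A u"
proof -
  have "1 + A\<^sup>2 / u\<^sup>2 = (A / u)\<^sup>2 * (1 + (u / A)\<^sup>2)"
    using assms by (simp add: field_simps)
  moreover have "0 < 1 + (u / A)\<^sup>2"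
    by (simp add: add_pos_nonneg)
  ultimately have "ln (1 + A\<^sup>2 / u\<^sup>2) = 2 * (ln A - ln u) + ln (1 + (u / A)\<^sup>2)"
    using assms by (simp add: ln_mult ln_div ln_realpow)
  then show ?thesis by (simp add: log_gap_def field_simps)
qed

lemma integrable_mult_exp_minus: "integrable lborel (\<lambda>u :: real. indicator {0<..} u * (u * exp (- u)))"
proof (rule integrable.intros[OF has_bochner_integral_nn_integral])
  have "(\<integral>\<^sup>+u. ennreal (indicator {0<..} u * (u * exp (- u))) \<partial>lborel) =
      (\<integral>\<^sup>+u. ennreal (u * exp (- u)) * indicator {0..} u \<partial>lborel)"
    by (intro nn_integral_cong) (auto split: split_indicator)
  also have "\<dots> = ennreal (0 - (- (0 + 1) * exp (- 0 :: real)))"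
  proof (rule nn_integral_FTC_atLeast)
    show "((\<lambda>u. - (u + 1) * exp (- u)) has_real_derivative u * exp (- u)) (at u)" for u :: real
      by (auto intro!: derivative_eq_intros simp: algebra_simps)
    show "((\<lambda>u :: real. - (u + 1) * exp (- u)) \<longlongrightarrow> 0) at_top"
      by real_asymp
  qed auto
  finally show "(\<integral>\<^sup>+u. ennreal (indicator {0<..} u * (u * exp (- u))) \<partial>lborel) = ennreal 1"
    by simp
qed (auto split: split_indicator)

lemma integrable_mult_kernel:
  fixes c :: real
  assumes "-1 < c" "c \<le> 1"
  shows "integrable lborel (\<lambda>u. indicator {0<..} u * (u / (cosh u + c)))"
proof (rule Bochner_Integration.integrable_bound)
  show "integrable lborel (\<lambda>u. 4 / (1 + c) * (indicator {0<..} u * (u * exp (- u))))"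
    by (intro integrable_mult_right integrable_mult_exp_minus)
  have "u / (cosh u + c) \<le> 4 / (1 + c) * (u * exp (- u))" if "0 < u" for u
  proof -
    have "u / (cosh u + c) \<le> u / ((1 + c) / 4 * exp u)"
      using that assms cosh_add_ge[OF assms, of u] by (intro divide_left_mono mult_pos_pos cosh_add_pos) auto
    then show ?thesis by (simp add: exp_minus field_simps)
  qed
  then show "AE u in lborel. norm (indicator {0<..} u * (u / (cosh u + c)))
      \<le> norm (4 / (1 + c) * (indicator {0<..} u * (u * exp (- u))))"
    using assms cosh_add_pos[OF assms(1)]
    by (intro AE_I2) (auto split: split_indicator simp: abs_mult less_imp_le)
qed measurable

lemma integrable_log_gap_kernel:
  fixes c :: real
  assumes "-1 < c" "0 \<le> A"
  shows "integrable lborel (\<lambda>u. indicator {0<..} u * (log_gap A u / (cosh u + c)))"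
proof (rule Bochner_Integration.integrable_bound)
  show "integrable lborel (\<lambda>u. 1 / (1 + c) * (indicator {0<..} u * log_gap A u))"
    by (intro integrable_mult_right integrable.intros[OF has_bochner_integral_log_gap] assms)
  have "log_gap A u / (cosh u + c) \<le> log_gap A u / (1 + c)" for u
    using assms cosh_real_ge_1[of u]
    by (intro divide_left_mono mult_pos_pos cosh_add_pos) (auto simp: log_gap_nonneg)
  then show "AE u in lborel. norm (indicator {0<..} u * (log_gap A u / (cosh u + c)))
      \<le> norm (1 / (1 + c) * (indicator {0<..} u * log_gap A u))"
    using assms cosh_add_pos[OF assms(1)]
    by (intro AE_I2) (auto split: split_indicator simp: less_imp_le log_gap_nonneg)
qed measurable

text \<open>The majorant \<open>log_gap 1 u + u\<close> of \<open>\<bar>ln u\<bar>\<close> treats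
  the two ends separately: the gap controls the singularity at 0, the linear term the growth at
  infinity.\<close>

lemma integrable_ln_kernel:
  fixes c :: real
  assumes "-1 < c" "c \<le> 1"
  shows "integrable lborel (\<lambda>u. indicator {0<..} u * (ln u / (cosh u + c)))"
proof (rule Bochner_Integration.integrable_bound)
  have "integrable lborel (\<lambda>u. indicator {0<..} u * (log_gap 1 u / (cosh u + c)) +
      indicator {0<..} u * (u / (cosh u + c)))"
    using assms
    by (intro Bochner_Integration.integrable_add integrable_mult_kernel integrable_log_gap_kernel) auto
  then show "integrable lborel (\<lambda>u. indicator {0<..} u * ((log_gap 1 u + u) / (cosh u + c)))"
    by (simp add: add_divide_distrib distrib_left)
  have "\<bar>ln u\<bar> / (cosh u + c) \<le> (log_gap 1 u + u) / (cosh u + c)" if "0 < u" for u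
  proof (rule divide_right_mono)
    have "0 \<le> ln (1 + u\<^sup>2)" by simp
    moreover have "ln u = ln (1 + u\<^sup>2) / 2 - log_gap 1 u"
      using that ln_eq_log_gap[of 1 u] by simp
    moreover note log_gap_nonneg[of 1 u] ln_one_plus_square_le[of u]
    ultimately show "\<bar>ln u\<bar> \<le> log_gap 1 u + u"
      using that by linarith
  qed (use cosh_add_pos[OF assms(1)] in \<open>auto intro: less_imp_le\<close>)
  then show "AE u in lborel. norm (indicator {0<..} u * (ln u / (cosh u + c)))
      \<le> norm (indicator {0<..} u * ((log_gap 1 u + u) / (cosh u + c)))"
    using cosh_add_pos[OF assms(1)]
    by (intro AE_I2) (simp split: split_indicator add: log_gap_nonneg abs_divide abs_of_pos)
qed measurable

text \<open>The substitution \<open>v = exp u\<close> gives a rational integrand with the arctangent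
  below as antiderivative. Twice that arctangent rises from \<open>pi - t\<close> at
  \<open>u = 0\<close> to \<open>pi\<close> at infinity.\<close>

lemma has_bochner_integral_kernel:
  fixes t :: real
  assumes "0 < t" "t < pi"
  shows "has_bochner_integral lborel (\<lambda>u. indicator {0<..} u * (sin t / (cosh u + cos t))) t"
proof (rule has_bochner_integral_nn_integral)
  have s: "0 < sin t" using assms by (simp add: sin_gt_zero)
  have c: "-1 < cos t" using assms by (intro cos_gt_minus_one) auto
  have "(\<integral>\<^sup>+u. ennreal (indicator {0<..} u * (sin t / (cosh u + cos t))) \<partial>lborel) =
      (\<integral>\<^sup>+u. ennreal (sin t / (cosh u + cos t)) * indicator {0..} u \<partial>lborel)"
    by (intro nn_integral_lborel_cong_except[of 0]) (auto split: split_indicator)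
  also have "\<dots> = ennreal (pi - 2 * arctan ((exp 0 + cos t) / sin t))"
  proof (rule nn_integral_FTC_atLeast)
    show "((\<lambda>u. 2 * arctan ((exp u + cos t) / sin t)) has_real_derivative sin t / (cosh u + cos t)) (at u)" for u
    proof -
      \<comment> \<open>Completing the square in
        \<open>(exp u)\<^sup>2 + 2 * exp u * cos t + 1\<close>.\<close>
      have eq: "(sin t)\<^sup>2 + (exp u + cos t)\<^sup>2 = 2 * exp u * (cosh u + cos t)"
      proof -
        have "2 * exp u * cosh u = (exp u)\<^sup>2 + 1"
          by (simp add: cosh_field_def exp_minus power2_eq_square field_simps)
        then show ?thesis using sin_cos_squared_add[of t] by algebra
      qed
      have "((\<lambda>u. 2 * arctan ((exp u + cos t) / sin t)) has_real_derivative
          2 * (exp u / sin t / (1 + ((exp u + cos t) / sin t)\<^sup>2))) (at u)"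
        using s by (auto intro!: derivative_eq_intros simp: field_simps)
      moreover have "exp u / sin t / (1 + ((exp u + cos t) / sin t)\<^sup>2) =
          exp u * sin t / ((sin t)\<^sup>2 + (exp u + cos t)\<^sup>2)"
        using s by (simp add: field_simps power2_eq_square)
      moreover have "2 * (exp u * sin t / (2 * exp u * (cosh u + cos t))) = sin t / (cosh u + cos t)"
        using cosh_add_pos[OF c, of u] by (simp add: divide_simps)
      ultimately show ?thesis
        by (simp only: eq)
    qed
    have "((\<lambda>u. 2 * arctan ((exp u + cos t) / sin t)) \<longlongrightarrow> 2 * (pi / 2)) at_top"
      using s by real_asymp
    then show "((\<lambda>u. 2 * arctan ((exp u + cos t) / sin t)) \<longlongrightarrow> pi) at_top" by simp
  qed (use s cosh_add_pos[OF c] in \<open>auto intro: less_imp_le\<close>)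
  \<comment> \<open>By the half-angle formulas the quotient is the cotangent of
    \<open>t / 2\<close>.\<close>
  also have "(exp 0 + cos t) / sin t = tan (pi / 2 - t / 2)"
  proof -
    have "cos t = 2 * (cos (t / 2))\<^sup>2 - 1" "sin t = 2 * sin (t / 2) * cos (t / 2)"
      using cos_double_cos[of "t / 2"] sin_double[of "t / 2"] by auto
    moreover have "0 < cos (t / 2)" "0 < sin (t / 2)"
      using assms by (auto intro!: cos_gt_zero_pi sin_gt_zero)
    ultimately show ?thesis
      by (simp add: tan_def cos_diff sin_diff power2_eq_square)
  qed
  also have "arctan (tan (pi / 2 - t / 2)) = pi / 2 - t / 2"
    using assms by (intro arctan_tan) auto
  finally show "(\<integral>\<^sup>+u. ennreal (indicator {0<..} u * (sin t / (cosh u + cos t))) \<partial>lborel) = ennreal t"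
    by simp
qed (use assms cosh_add_pos[OF cos_gt_minus_one[of t]] in
    \<open>auto split: split_indicator simp: sin_ge_zero less_imp_le\<close>)

section \<open>Termwise integration and telescoping\<close>

text \<open>A bound uniform in \<open>u\<close>, needed for a summable majorant. Over the common
  denominator the numerator is \<open>(a - b) * (u\<^sup>2 - a * b)\<close>. Since
  \<open>m\<^sup>2\<close> is at most \<open>a * b\<close> and at most
  \<open>a\<^sup>2 + b\<^sup>2\<close>, the expanded denominator dominates
  \<open>(u\<^sup>2 + a * b) * m\<^sup>2\<close>.\<close>

lemma abs_Poisson_diff_le:
  fixes a b m u :: real
  assumes "0 < m" "m \<le> a" "m \<le> b"
  shows "\<bar>a / (a\<^sup>2 + u\<^sup>2) - b / (b\<^sup>2 + u\<^sup>2)\<bar> \<le> \<bar>a - b\<bar> / m\<^sup>2"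
proof -
  have p: "0 < a\<^sup>2 + u\<^sup>2" "0 < b\<^sup>2 + u\<^sup>2" "0 < m\<^sup>2"
    using assms by (auto simp: add_pos_nonneg)
  have ab: "m\<^sup>2 \<le> a * b" "m\<^sup>2 \<le> a\<^sup>2 + b\<^sup>2"
    using assms mult_mono[of m a m b] power_mono[of m a 2] by (auto simp: power2_eq_square add_increasing2)
  have "(u\<^sup>2 + a * b) * m\<^sup>2 = u\<^sup>2 * m\<^sup>2 + a * b * m\<^sup>2" by algebra
  also have "\<dots> \<le> u\<^sup>2 * (a\<^sup>2 + b\<^sup>2) + a * b * (a * b)"
    using ab assms by (intro add_mono mult_left_mono) auto
  also have "\<dots> \<le> (a\<^sup>2 + u\<^sup>2) * (b\<^sup>2 + u\<^sup>2)"
    using zero_le_power2[of "u * u"] by (simp add: power2_eq_square algebra_simps)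
  finally have key: "(u\<^sup>2 + a * b) * m\<^sup>2 \<le> (a\<^sup>2 + u\<^sup>2) * (b\<^sup>2 + u\<^sup>2)" .
  have "a / (a\<^sup>2 + u\<^sup>2) - b / (b\<^sup>2 + u\<^sup>2) = (a - b) * (u\<^sup>2 - a * b) / ((a\<^sup>2 + u\<^sup>2) * (b\<^sup>2 + u\<^sup>2))"
    using p[THEN less_imp_neq, THEN not_sym] by (simp add: divide_simps) algebra
  then have "\<bar>a / (a\<^sup>2 + u\<^sup>2) - b / (b\<^sup>2 + u\<^sup>2)\<bar> = \<bar>a - b\<bar> * \<bar>u\<^sup>2 - a * b\<bar> / ((a\<^sup>2 + u\<^sup>2) * (b\<^sup>2 + u\<^sup>2))"
    using p by (simp add: abs_mult)
  also have "\<dots> \<le> \<bar>a - b\<bar> * (u\<^sup>2 + a * b) / ((a\<^sup>2 + u\<^sup>2) * (b\<^sup>2 + u\<^sup>2))"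
    using p assms by (intro divide_right_mono mult_left_mono) (auto simp: abs_if)
  also have "\<dots> = \<bar>a - b\<bar> * ((u\<^sup>2 + a * b) / ((a\<^sup>2 + u\<^sup>2) * (b\<^sup>2 + u\<^sup>2)))"
    by simp
  also have "\<dots> \<le> \<bar>a - b\<bar> * (1 / m\<^sup>2)"
    using p key by (intro mult_left_mono) (auto simp: divide_simps)
  finally show ?thesis by simp
qed

text \<open>The sum of \<open>h\<close> over the first \<open>m + n\<close> indices is split once at
  \<open>m\<close> and once at \<open>n\<close>. The exchange turns a growing number of terms with a
  fixed shift into a fixed number of terms with a growing shift.\<close>

lemma sum_diff_shift_swap:
  fixes h :: "nat \<Rightarrow> real"
  shows "(\<Sum>k<m. h k - h (k + n)) = (\<Sum>k<n. h k - h (k + m))"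
proof -
  have "(\<Sum>k<m. h k) + (\<Sum>k<n. h (k + m)) = (\<Sum>k<n. h k) + (\<Sum>k<m. h (k + n))"
    using sum.atLeastLessThan_concat[of 0 m "m + n" h] sum.atLeastLessThan_concat[of 0 n "m + n" h]
      sum.shift_bounds_nat_ivl[of h 0 m n] sum.shift_bounds_nat_ivl[of h 0 n m]
    by (simp add: atLeast0LessThan add.commute)
  then show ?thesis by (simp add: sum_subtractf)
qed

text \<open>With \<open>A = 2 pi n\<close>, adding \<open>A\<close> to \<open>a k\<close> gives
  \<open>a (k + n)\<close>, so the \<open>k\<close>-th term of the expansion integrates to a
  multiple of \<open>h k - h (k + n)\<close>. As \<open>h\<close> tends to 0, the sum over all
  \<open>k\<close> leaves only the first \<open>n\<close> values of \<open>h\<close>.\<close>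

lemma integral_log_gap_kernel:
  fixes t :: real and n :: nat
  assumes "0 < t" "t < pi"
  defines "a \<equiv> \<lambda>k. (2 * real k + 1) * pi"
  shows "(\<integral>u. indicator {0<..} u * (log_gap (2 * pi * real n) u * (sin t / (cosh u + cos t))) \<partial>lborel) =
    pi * (\<Sum>k<n. ln (a k + t) - ln (a k - t))"
proof -
  define A where "A = 2 * pi * real n"
  define h where "h k = ln (a k + t) - ln (a k - t)" for k
  define f where "f k u = 2 * ((a k - t) / ((a k - t)\<^sup>2 + u\<^sup>2) - (a k + t) / ((a k + t)\<^sup>2 + u\<^sup>2))" for k u
  \<comment> \<open>From \<open>abs_Poisson_diff_le\<close> with
    \<open>m = (k + 1) * (pi - t)\<close>: the two parameters differ by \<open>2 * t\<close>, and
    \<open>f\<close> carries another factor 2.\<close>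
  define C where "C k = 4 * t / (pi - t)\<^sup>2 * inverse ((real (Suc k))\<^sup>2)" for k
  have A: "0 \<le> A" by (simp add: A_def)
  \<comment> \<open>The difference of the two sides is \<open>k * (pi + t)\<close>.\<close>
  have a_ge: "real (Suc k) * (pi - t) \<le> a k - t" for k
    using assms by (simp add: a_def algebra_simps)
  have a_pos: "0 < a k - t" "0 < a k + t" for k
  proof -
    have "0 < real (Suc k) * (pi - t)" using assms by (intro mult_pos_pos) auto
    then show "0 < a k - t" "0 < a k + t" using a_ge[of k] assms by linarith+
  qed
  have shift: "a k + A = a (k + n)" for k
    by (simp add: a_def A_def algebra_simps)
  have int: "has_bochner_integral lborel (\<lambda>u. indicator {0<..} u * (log_gap A u * f k u)) (pi * (h k - h (k + n)))" for k
  proof -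
    have "has_bochner_integral lborel
       (\<lambda>u. 2 * (indicator {0<..} u * (log_gap A u * ((a k - t) / (u\<^sup>2 + (a k - t)\<^sup>2))) -
             indicator {0<..} u * (log_gap A u * ((a k + t) / (u\<^sup>2 + (a k + t)\<^sup>2)))))
       (2 * (pi / 2 * (ln ((a k - t) + A) - ln (a k - t)) - pi / 2 * (ln ((a k + t) + A) - ln (a k + t))))"
      by (intro has_bochner_integral_mult_right has_bochner_integral_diff
          has_bochner_integral_log_gap_Poisson A a_pos)
    also have "2 * (pi / 2 * (ln ((a k - t) + A) - ln (a k - t)) - pi / 2 * (ln ((a k + t) + A) - ln (a k + t))) =
        pi * (h k - h (k + n))"
      by (simp add: h_def algebra_simps flip: shift)
    finally show ?thesis
      by (simp add: f_def algebra_simps)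
  qed
  have f_le: "\<bar>f k u\<bar> \<le> C k" for k u
  proof -
    have "\<bar>(a k - t) / ((a k - t)\<^sup>2 + u\<^sup>2) - (a k + t) / ((a k + t)\<^sup>2 + u\<^sup>2)\<bar> \<le>
        \<bar>(a k - t) - (a k + t)\<bar> / (real (Suc k) * (pi - t))\<^sup>2"
      using a_ge[of k] assms by (intro abs_Poisson_diff_le) auto
    also have "\<dots> = 2 * t / (pi - t)\<^sup>2 * inverse ((real (Suc k))\<^sup>2)"
      using assms by (simp add: power_mult_distrib divide_inverse del: of_nat_Suc)
    finally have "\<bar>2\<bar> * \<bar>(a k - t) / ((a k - t)\<^sup>2 + u\<^sup>2) - (a k + t) / ((a k + t)\<^sup>2 + u\<^sup>2)\<bar> \<le>
        2 * (2 * t / (pi - t)\<^sup>2 * inverse ((real (Suc k))\<^sup>2))"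
      by (subst abs_numeral) (rule mult_left_mono, simp_all)
    also have "\<dots> = C k" by (simp add: C_def)
    finally show ?thesis unfolding f_def abs_mult .
  qed
  have C: "summable C"
    unfolding C_def using inverse_power_summable[of 2]
    by (intro summable_mult) (subst summable_Suc_iff[of "\<lambda>k. inverse ((real k)\<^sup>2)"], auto)
  have C_nonneg: "0 \<le> C k" for k
    using f_le[of k 0] by linarith
  \<comment> \<open>Dominated convergence: the partial sums are bounded by \<open>suminf C\<close>
    uniformly in \<open>u\<close>, and the gap supplies the integrability.\<close>
  have L1: "(\<lambda>m. \<integral>u. indicator {0<..} u * (log_gap A u * (\<Sum>k<m. f k u)) \<partial>lborel) \<longlonglongrightarrow>
      (\<integral>u. indicator {0<..} u * (log_gap A u * (sin t / (cosh u + cos t))) \<partial>lborel)"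
  proof (rule integral_dominated_convergence)
    show "integrable lborel (\<lambda>u. suminf C * (indicator {0<..} u * log_gap A u))"
      by (intro integrable_mult_right integrable.intros[OF has_bochner_integral_log_gap] A)
    show "AE u in lborel. (\<lambda>m. indicator {0<..} u * (log_gap A u * (\<Sum>k<m. f k u)))
        \<longlonglongrightarrow> indicator {0<..} u * (log_gap A u * (sin t / (cosh u + cos t)))"
      using sums_kernel_partial_fractions[OF assms(1,2)]
      by (intro AE_I2 tendsto_intros) (simp add: sums_def f_def a_def)
    have "\<bar>\<Sum>k<m. f k u\<bar> \<le> suminf C" for m u
    proof -
      have "\<bar>\<Sum>k<m. f k u\<bar> \<le> (\<Sum>k<m. C k)"
        by (intro order_trans[OF sum_abs] sum_mono f_le)
      also have "\<dots> \<le> suminf C" by (intro sum_le_suminf C C_nonneg) auto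
      finally show ?thesis .
    qed
    then show "AE u in lborel. norm (indicator {0<..} u * (log_gap A u * (\<Sum>k<m. f k u)))
        \<le> suminf C * (indicator {0<..} u * log_gap A u)" for m
      by (intro AE_I2) (auto split: split_indicator simp: abs_mult log_gap_nonneg mult.commute[of "suminf C"] intro: mult_left_mono)
  qed (simp_all add: f_def)
  have L2: "(\<integral>u. indicator {0<..} u * (log_gap A u * (\<Sum>k<m. f k u)) \<partial>lborel) =
      pi * (\<Sum>k<n. h k - h (k + m))" for m
  proof -
    have "has_bochner_integral lborel (\<lambda>u. \<Sum>k<m. indicator {0<..} u * (log_gap A u * f k u))
        (\<Sum>k<m. pi * (h k - h (k + n)))"
      by (intro has_bochner_integral_sum int)
    then show ?thesis
      by (simp add: has_bochner_integral_iff sum_distrib_left[symmetric] sum_diff_shift_swap[of h m n])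
  qed
  \<comment> \<open>After the exchange of shift and length only \<open>n\<close> terms remain, so
    the limit is taken term by term.\<close>
  have L3: "(\<lambda>m. pi * (\<Sum>k<n. h k - h (k + m))) \<longlonglongrightarrow> pi * (\<Sum>k<n. h k - 0)"
  proof -
    have "(\<lambda>m. h (k + m)) \<longlonglongrightarrow> 0" for k
      unfolding h_def a_def using assms by real_asymp
    then show ?thesis by (intro tendsto_intros)
  qed
  show ?thesis
    using LIMSEQ_unique[OF L1[unfolded L2] L3] by (simp add: A_def h_def)
qed

section \<open>Gauss's product and the logarithmic integral\<close>

text \<open>Logarithm of the quotient of Gauss's products at \<open>1 / 2 + s\<close> and
  \<open>1 / 2 - s\<close>: the factorials cancel, the powers of \<open>n\<close> leave
  \<open>2 * s * ln n\<close>, and the Pochhammer symbols give the sum.\<close>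

lemma tendsto_ln_Gamma_quotient:
  fixes s :: real
  assumes "\<bar>s\<bar> < 1 / 2"
  shows "(\<lambda>n. 2 * s * ln (real n) - (\<Sum>k<n. ln (real k + 1 / 2 + s) - ln (real k + 1 / 2 - s)))
    \<longlonglongrightarrow> ln (Gamma (1 / 2 + s) / Gamma (1 / 2 - s))"
proof -
  have ln_series: "ln (Gamma_series' z n) = ln (fact (n - 1)) + z * ln (real n) - (\<Sum>k<n. ln (z + real k))"
    and series_pos: "0 < Gamma_series' z n" if "0 < z" for z :: real and n
  proof -
    have p: "0 < pochhammer z n" using that by (rule pochhammer_pos)
    then show "0 < Gamma_series' z n" by (simp add: Gamma_series'_def)
    have "ln (pochhammer z n) = (\<Sum>k<n. ln (z + real k))"
      unfolding pochhammer_prod atLeast0LessThan using that by (intro ln_prod) auto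
    then show "ln (Gamma_series' z n) = ln (fact (n - 1)) + z * ln (real n) - (\<Sum>k<n. ln (z + real k))"
      using p by (simp add: Gamma_series'_def ln_div ln_mult)
  qed
  have z: "0 < 1 / 2 + s" "0 < 1 / 2 - s" using assms by auto
  then have "(\<lambda>n. ln (Gamma_series' (1 / 2 + s) n / Gamma_series' (1 / 2 - s) n))
      \<longlonglongrightarrow> ln (Gamma (1 / 2 + s) / Gamma (1 / 2 - s))"
    by (intro tendsto_intros Gamma_series'_LIMSEQ) (auto simp: Gamma_real_pos less_imp_neq[THEN not_sym])
  moreover have "ln (Gamma_series' (1 / 2 + s) n / Gamma_series' (1 / 2 - s) n) =
      2 * s * ln (real n) - (\<Sum>k<n. ln (real k + 1 / 2 + s) - ln (real k + 1 / 2 - s))" for n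
    using z series_pos[OF z(1), of n] series_pos[OF z(2), of n]
    by (simp add: ln_div ln_series sum_subtractf algebra_simps)
  ultimately show ?thesis by simp
qed

text \<open>Integrating \<open>ln_eq_log_gap\<close> at \<open>A n\<close> gives an identity that is
  exact for every \<open>n\<close>. Its left side does not depend on \<open>n\<close>, so only the
  limits of the error \<open>E\<close> and of Gauss's product \<open>P\<close> remain to be
  found.\<close>

lemma integral_ln_kernel:
  fixes t :: real
  assumes "0 < t" "t < pi"
  shows "(\<integral>u. indicator {0<..} u * (ln u * (sin t / (cosh u + cos t))) \<partial>lborel) =
    t * ln (2 * pi) + pi * ln (Gamma (1 / 2 + t / (2 * pi)) / Gamma (1 / 2 - t / (2 * pi)))"
proof -
  define I where "I = (\<integral>u. indicator {0<..} u * (ln u * (sin t / (cosh u + cos t))) \<partial>lborel)"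
  \<comment> \<open>The successor keeps \<open>A n \<ge> 1\<close>, so that \<open>ln (A n)\<close>
    makes sense and \<open>u / A n \<le> u\<close> yields a majorant independent of
    \<open>n\<close>.\<close>
  define A where "A n = 2 * pi * real (Suc n)" for n
  define s where "s = t / (2 * pi)"
  define P where "P n = 2 * s * ln (real n) - (\<Sum>k<n. ln (real k + 1 / 2 + s) - ln (real k + 1 / 2 - s))" for n
  define E where "E n = (\<integral>u. indicator {0<..} u * (ln (1 + (u / A n)\<^sup>2) / 2 * (sin t / (cosh u + cos t))) \<partial>lborel)" for n
  have A: "0 < A n" "1 \<le> A n" for n
  proof -
    have "1 * 1 \<le> 2 * pi * real (Suc n)"
      using pi_gt3 by (intro mult_mono) auto
    then show "0 < A n" "1 \<le> A n" by (auto simp: A_def)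
  qed
  have c: "-1 < cos t" "cos t \<le> 1" and sin: "0 < sin t"
    using assms by (auto intro!: cos_gt_minus_one sin_gt_zero)
  note K_pos = cosh_add_pos[OF c(1)]
  have s: "\<bar>s\<bar> < 1 / 2" using assms by (simp add: s_def field_simps)
  have scale: "integrable lborel (\<lambda>u. indicator {0<..} u * (f u * (sin t / (cosh u + cos t))))"
    if "integrable lborel (\<lambda>u. indicator {0<..} u * (f u / (cosh u + cos t)))" for f :: "real \<Rightarrow> real"
    using integrable_mult_right[OF that, of "sin t"] by (simp add: mult_ac)
  have bound: "norm (indicator {0<..} u * (ln (1 + (u / A n)\<^sup>2) / 2 * (sin t / (cosh u + cos t)))) \<le>
      indicator {0<..} u * (u * (sin t / (cosh u + cos t)))" for n u
  proof (cases "0 < u")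
    case True
    then have "ln (1 + (u / A n)\<^sup>2) / 2 \<le> u / A n"
      using A by (intro ln_one_plus_square_le) (simp add: less_imp_le)
    also have "\<dots> \<le> u" using A[of n] True by (simp add: field_simps)
    finally have le: "ln (1 + (u / A n)\<^sup>2) / 2 \<le> u" .
    have mono: "norm (1 * (x * k)) \<le> 1 * (u * k)" if "0 \<le> x" "x \<le> u" "0 \<le> k" for x k :: real
      using that by (simp add: mult_right_mono)
    have ind: "indicator {0<..} u = (1 :: real)"
      using True by simp
    show ?thesis
      unfolding ind by (rule mono[OF _ le]) (use sin K_pos[of u] in auto)
  qed simp
  have dom: "integrable lborel (\<lambda>u. indicator {0<..} u * (u * (sin t / (cosh u + cos t))))"
    by (intro scale integrable_mult_kernel c)
  have int_E: "integrable lborel (\<lambda>u. indicator {0<..} u * (ln (1 + (u / A n)\<^sup>2) / 2 * (sin t / (cosh u + cos t))))" for n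
    by (rule Bochner_Integration.integrable_bound[OF dom], measurable)
      (intro AE_I2 order_trans[OF bound], simp only: real_norm_def abs_ge_self)
  \<comment> \<open>The integrand tends to 0 pointwise and is dominated by \<open>u\<close> times
    the kernel.\<close>
  have "E \<longlonglongrightarrow> (\<integral>u. 0 \<partial>(lborel :: real measure))"
    unfolding E_def
  proof (rule integral_dominated_convergence)
    show "integrable lborel (\<lambda>u. indicator {0<..} u * (u * (sin t / (cosh u + cos t))))"
      by (rule dom)
    have "(\<lambda>n. 1 / A n) \<longlonglongrightarrow> 0"
      unfolding A_def by real_asymp
    then have "(\<lambda>n. ln (1 + (u * (1 / A n))\<^sup>2)) \<longlonglongrightarrow> ln (1 + (u * 0)\<^sup>2)" for u
      by (intro tendsto_intros) auto
    then have "(\<lambda>n. ln (1 + (u / A n)\<^sup>2)) \<longlonglongrightarrow> 0" for u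
      by simp
    then have "(\<lambda>n. indicator {0<..} u * (ln (1 + (u / A n)\<^sup>2) / 2 * (sin t / (cosh u + cos t)))) \<longlonglongrightarrow>
        indicator {0<..} u * (0 / 2 * (sin t / (cosh u + cos t)))" for u
      by (intro tendsto_intros) auto
    then show "AE u in lborel. (\<lambda>n. indicator {0<..} u * (ln (1 + (u / A n)\<^sup>2) / 2 * (sin t / (cosh u + cos t)))) \<longlonglongrightarrow> 0"
      by simp
    show "AE u in lborel. norm (indicator {0<..} u * (ln (1 + (u / A n)\<^sup>2) / 2 * (sin t / (cosh u + cos t))))
      \<le> indicator {0<..} u * (u * (sin t / (cosh u + cos t)))" for n
      by (intro AE_I2 bound)
  qed measurable
  then have E: "E \<longlonglongrightarrow> 0" by simp
  have I_eq: "I = t * ln (2 * pi) + pi * P (Suc n) + E n" for n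
  proof -
    have "I = (\<integral>u. ln (A n) * (indicator {0<..} u * (sin t / (cosh u + cos t))) +
        indicator {0<..} u * (ln (1 + (u / A n)\<^sup>2) / 2 * (sin t / (cosh u + cos t))) -
        indicator {0<..} u * (log_gap (A n) u * (sin t / (cosh u + cos t))) \<partial>lborel)"
      unfolding I_def
    proof (intro Bochner_Integration.integral_cong refl)
      fix u :: real
      show "indicator {0<..} u * (ln u * (sin t / (cosh u + cos t))) =
          ln (A n) * (indicator {0<..} u * (sin t / (cosh u + cos t))) +
          indicator {0<..} u * (ln (1 + (u / A n)\<^sup>2) / 2 * (sin t / (cosh u + cos t))) -
          indicator {0<..} u * (log_gap (A n) u * (sin t / (cosh u + cos t)))"
      proof (cases "0 < u")
        case True
        have "1 * ((a + b - d) * k) = a * (1 * k) + 1 * (b * k) - 1 * (d * k)" for a b d k :: real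
          by (simp add: algebra_simps)
        moreover have "indicator {0<..} u = (1 :: real)"
          using True by simp
        ultimately show ?thesis
          unfolding ln_eq_log_gap[OF A(1)[of n] True] by (simp only:)
      qed simp
    qed
    also have "\<dots> = ln (A n) * t + E n - pi * (\<Sum>k<Suc n. ln ((2 * real k + 1) * pi + t) - ln ((2 * real k + 1) * pi - t))"
    proof -
      have K: "has_bochner_integral lborel (\<lambda>u. ln (A n) * (indicator {0<..} u * (sin t / (cosh u + cos t)))) (ln (A n) * t)"
        by (intro has_bochner_integral_mult_right has_bochner_integral_kernel assms)
      have G: "integrable lborel (\<lambda>u. indicator {0<..} u * (log_gap (A n) u * (sin t / (cosh u + cos t))))"
        using A[of n] c by (intro scale integrable_log_gap_kernel) auto
      note G = has_bochner_integral_integrable[OF G, unfolded integral_log_gap_kernel[OF assms, of "Suc n", folded A_def]]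
      show ?thesis
        unfolding E_def
        by (intro has_bochner_integral_integral_eq has_bochner_integral_diff has_bochner_integral_add
            K has_bochner_integral_integrable[OF int_E] G)
    qed
    \<comment> \<open>Each of the two logarithms contains the same summand
      \<open>ln (2 * pi)\<close>, which cancels.\<close>
    also have "(\<Sum>k<Suc n. ln ((2 * real k + 1) * pi + t) - ln ((2 * real k + 1) * pi - t)) =
        (\<Sum>k<Suc n. ln (real k + 1 / 2 + s) - ln (real k + 1 / 2 - s))" (is "_ = ?S")
    proof (rule sum.cong)
      fix k
      have "(2 * real k + 1) * pi + t = 2 * pi * (real k + 1 / 2 + s)"
        "(2 * real k + 1) * pi - t = 2 * pi * (real k + 1 / 2 - s)"
        by (simp_all add: s_def field_simps)
      moreover have "0 < real k + 1 / 2 + s" "0 < real k + 1 / 2 - s"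
        using s by linarith+
      ultimately show "ln ((2 * real k + 1) * pi + t) - ln ((2 * real k + 1) * pi - t) =
          ln (real k + 1 / 2 + s) - ln (real k + 1 / 2 - s)"
        by (simp add: ln_mult)
    qed simp
    also have "ln (A n) = ln (2 * pi) + ln (real (Suc n))"
      by (simp add: A_def ln_mult)
    finally have I: "I = (ln (2 * pi) + ln (real (Suc n))) * t + E n - pi * ?S" .
    \<comment> \<open>The divergent part \<open>t * ln (n + 1)\<close> of
      \<open>t * ln (A n)\<close> is exactly \<open>pi\<close> times the normalising term of
      \<open>P (Suc n)\<close>.\<close>
    have "P (Suc n) = 2 * s * ln (real (Suc n)) - ?S" "t = 2 * pi * s"
      by (simp_all add: P_def s_def)
    then show ?thesis
      unfolding I by algebra
  qed
  have "P \<longlonglongrightarrow> ln (Gamma (1 / 2 + s) / Gamma (1 / 2 - s))"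
    unfolding P_def by (rule tendsto_ln_Gamma_quotient[OF s])
  then have "(\<lambda>n. t * ln (2 * pi) + pi * P (Suc n) + E n) \<longlonglongrightarrow>
      t * ln (2 * pi) + pi * ln (Gamma (1 / 2 + s) / Gamma (1 / 2 - s)) + 0"
    by (intro tendsto_add tendsto_mult tendsto_const E LIMSEQ_Suc)
  then have "(\<lambda>n. I) \<longlonglongrightarrow> t * ln (2 * pi) + pi * ln (Gamma (1 / 2 + s) / Gamma (1 / 2 - s)) + 0"
    by (simp only: I_eq[symmetric])
  then show ?thesis
    by (simp only: I_def s_def LIMSEQ_const_iff add_0_right)
qed

section \<open>Return to the integral over the unit interval\<close>

text \<open>Under \<open>x = exp (- u)\<close> the denominator becomes
  \<open>2 * x * (cosh u + cos t)\<close>, and its factor \<open>x\<close> cancels against the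
  Jacobian.\<close>

lemma
  fixes t :: real
  assumes "\<bar>t\<bar> < pi"
  shows set_integrable_log_log_integrand: "set_integrable lborel {0<..<1} (log_log_integrand t)"
    and set_integral_log_log_integrand: "(LBINT x:{0<..<1}. log_log_integrand t x) =
      (\<integral>u. indicator {0<..} u * (ln u / (cosh u + cos t)) \<partial>lborel) / 2"
proof -
  have c: "-1 < cos t" "cos t \<le> 1"
    using assms by (auto intro!: cos_gt_minus_one)
  define f where "f u = ln u / (cosh u + cos t) / 2" for u
  have f_eq: "\<bar>- exp (- u)\<bar> * log_log_integrand t (exp (- u)) = f u" for u
  proof -
    have "1 + 2 * exp (- u) * cos t + (exp (- u))\<^sup>2 = 2 * exp (- u) * (cosh u + cos t)"
      by (simp add: cosh_field_def exp_minus power2_eq_square field_simps)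
    then show ?thesis
      using cosh_add_pos[OF c(1), of u] by (simp add: log_log_integrand_def f_def)
  qed
  have "integrable lborel (\<lambda>u. (indicator {0<..} u * (ln u / (cosh u + cos t))) / 2)"
    by (intro integrable_divide integrable_ln_kernel c)
  then have int: "set_integrable lborel {0<..} f"
    by (simp add: set_integrable_def f_def)
  \<comment> \<open>The change of variables is carried out for the completed Lebesgue measure; Borel
    measurability allows the passage there and back.\<close>
  then have "f absolutely_integrable_on {0<..}"
    unfolding set_integrable_def by (subst integrable_completion) (auto intro: borel_measurable_integrable)
  then have "(\<lambda>u. \<bar>- exp (- u)\<bar> * log_log_integrand t (exp (- u))) absolutely_integrable_on {0<..} \<and>
      integral {0<..} (\<lambda>u. \<bar>- exp (- u)\<bar> * log_log_integrand t (exp (- u))) = integral {0<..} f"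
    unfolding f_eq by simp
  then have "log_log_integrand t absolutely_integrable_on ((\<lambda>u. exp (- u)) ` {0<..}) \<and>
      integral ((\<lambda>u. exp (- u)) ` {0<..}) (log_log_integrand t) = integral {0<..} f"
    by (subst (asm) has_absolute_integral_change_of_variables_1')
      (auto intro!: derivative_eq_intros simp: inj_on_def)
  moreover have "(\<lambda>u :: real. exp (- u)) ` {0<..} = {0<..<1}"
  proof (intro equalityI subsetI)
    fix x :: real assume "x \<in> {0<..<1}"
    then have "x = exp (- (- ln x))" "- ln x \<in> {0<..}" by auto
    then show "x \<in> (\<lambda>u. exp (- u)) ` {0<..}" by blast
  qed auto
  ultimately have ai: "log_log_integrand t absolutely_integrable_on {0<..<1}"
    and eq: "integral {0<..<1} (log_log_integrand t) = integral {0<..} f" by auto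
  show *: "set_integrable lborel {0<..<1} (log_log_integrand t)"
    using ai unfolding set_integrable_def
    by (subst (asm) integrable_completion) (auto simp: log_log_integrand_def)
  have "(LBINT x:{0<..<1}. log_log_integrand t x) = (LBINT u:{0<..}. f u)"
    using set_borel_integral_eq_integral(2)[OF *] set_borel_integral_eq_integral(2)[OF int] eq
    by (simp only:)
  also have "\<dots> = (\<integral>u. indicator {0<..} u * (ln u / (cosh u + cos t)) \<partial>lborel) / 2"
    unfolding set_lebesgue_integral_def f_def
    by (subst integral_divide_zero[symmetric]) simp
  finally show "(LBINT x:{0<..<1}. log_log_integrand t x) =
      (\<integral>u. indicator {0<..} u * (ln u / (cosh u + cos t)) \<partial>lborel) / 2" .
qed

text \<open>Changing the sign of \<open>t\<close> inverts the argument of the logarithm, and the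
  sign this produces cancels against that of \<open>sin t\<close>.\<close>

lemma log_log_closed_form_minus:
  assumes "\<bar>t\<bar> < pi"
  shows "log_log_closed_form (- t) = log_log_closed_form t"
proof -
  define s where "s = t / (2 * pi)"
  have "\<bar>s\<bar> < 1 / 2"
    using assms by (simp add: s_def field_simps)
  then have "0 < Gamma (1 / 2 + s)" "0 < Gamma (1 / 2 - s)"
    by (intro Gamma_real_pos; linarith)+
  then have "0 < (2 * pi) powr (t / pi) * Gamma (1 / 2 + s) / Gamma (1 / 2 - s)" (is "0 < ?X")
    by simp
  moreover have "(2 * pi) powr (- t / pi) * Gamma (1 / 2 + - s) / Gamma (1 / 2 - - s) = inverse ?X"
  proof -
    have "inverse p * a / b = inverse (p * b / a)" for p a b :: real
      by (simp add: divide_simps)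
    then show ?thesis
      by (simp only: minus_divide_left[symmetric] powr_minus diff_minus_eq_add add_uminus_conv_diff)
  qed
  moreover have "- t / (2 * pi) = - s"
    by (simp add: s_def)
  ultimately show ?thesis
    unfolding log_log_closed_form_def s_def[symmetric]
    by (simp only: ln_inverse sin_minus)
qed

lemma integral_eq_log_log_closed_form:
  fixes t :: real
  assumes "\<bar>t\<bar> < pi" "t \<noteq> 0"
  shows "(LBINT x:{0<..<1}. log_log_integrand t x) = log_log_closed_form t"
proof -
  have pos: "(LBINT x:{0<..<1}. log_log_integrand t x) = log_log_closed_form t" if "0 < t" "t < pi" for t
  proof -
    have s: "0 < sin t" using that by (simp add: sin_gt_zero)
    have g: "0 < Gamma (1 / 2 + t / (2 * pi))" "0 < Gamma (1 / 2 - t / (2 * pi))"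
      using that by (auto intro!: Gamma_real_pos simp: field_simps add_pos_pos)
    define J where "J = (\<integral>u. indicator {0<..} u * (ln u / (cosh u + cos t)) \<partial>lborel)"
    have "(LBINT x:{0<..<1}. log_log_integrand t x) = J / 2"
      unfolding J_def using that by (intro set_integral_log_log_integrand) auto
    \<comment> \<open>The factor \<open>sin t\<close> normalises the kernel to the form used in
      \<open>integral_ln_kernel\<close>.\<close>
    also have "\<dots> = (sin t * J) / (2 * sin t)"
      using s by simp
    also have "sin t * J = (\<integral>u. indicator {0<..} u * (ln u * (sin t / (cosh u + cos t))) \<partial>lborel)"
      unfolding J_def by (subst integral_mult_right_zero[symmetric]) (simp add: mult_ac)
    also have "\<dots> = t * ln (2 * pi) + pi * ln (Gamma (1 / 2 + t / (2 * pi)) / Gamma (1 / 2 - t / (2 * pi)))"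
      using that by (rule integral_ln_kernel)
    also have "t * ln (2 * pi) + pi * ln (Gamma (1 / 2 + t / (2 * pi)) / Gamma (1 / 2 - t / (2 * pi))) =
        pi * ln ((2 * pi) powr (t / pi) * Gamma (1 / 2 + t / (2 * pi)) / Gamma (1 / 2 - t / (2 * pi)))"
      using g by (simp add: ln_mult ln_div ln_powr algebra_simps)
    finally show ?thesis by (simp add: log_log_closed_form_def)
  qed
  show ?thesis
  proof (cases "0 < t")
    case True
    then show ?thesis using pos assms by simp
  next
    \<comment> \<open>Here \<open>t < 0\<close>; the integrand depends on \<open>t\<close> only
      through \<open>cos t\<close>, so both sides are even.\<close>
    case False
    then have "(LBINT x:{0<..<1}. log_log_integrand (- t) x) = log_log_closed_form (- t)"
      using pos assms by auto
    moreover have "log_log_integrand (- t) = log_log_integrand t"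
      by (simp add: log_log_integrand_def fun_eq_iff)
    ultimately show ?thesis using log_log_closed_form_minus[OF assms(1)] by simp
  qed
qed

section \<open>The limiting case \<open>t = 0\<close>\<close>

text \<open>For parameters within \<open>pi / 2\<close> of 0 the cosine is positive, so the
  denominator is at least 1, while \<open>1 \<le> 2 / (1 + x\<^sup>2)\<close> on the unit interval.
  As \<open>cos (pi / 2) = 0\<close>, twice the absolute integrand at \<open>pi / 2\<close> is
  therefore an integrable majorant.\<close>

lemma tendsto_integral_log_log_integrand:
  "((\<lambda>t. LBINT x:{0<..<1}. log_log_integrand t x) \<longlongrightarrow> (LBINT x:{0<..<1}. log_log_integrand 0 x)) (at 0)"
  unfolding tendsto_at_iff_sequentially comp_def
proof (intro allI impI)
  fix X :: "nat \<Rightarrow> real" assume X: "X \<longlonglongrightarrow> 0"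
  then have "eventually (\<lambda>n. X n \<in> {- (pi / 2)<..<pi / 2}) sequentially"
    by (rule topological_tendstoD) auto
  then obtain N where N: "\<And>n. N \<le> n \<Longrightarrow> X n \<in> {- (pi / 2)<..<pi / 2}"
    by (auto simp: eventually_sequentially)
  have XN: "(\<lambda>n. X (n + N)) \<longlonglongrightarrow> 0" using X by (rule LIMSEQ_ignore_initial_segment)
  have "(\<lambda>n. LBINT x:{0<..<1}. log_log_integrand (X (n + N)) x) \<longlonglongrightarrow> (LBINT x:{0<..<1}. log_log_integrand 0 x)"
    unfolding set_lebesgue_integral_def
  proof (rule integral_dominated_convergence)
    show "integrable lborel (\<lambda>x. 2 * norm (indicator {0<..<1} x *\<^sub>R log_log_integrand (pi / 2) x))"
      using set_integrable_log_log_integrand[of "pi / 2"] unfolding set_integrable_def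
      by (intro integrable_mult_right integrable_norm) auto
    have "(\<lambda>n. log_log_integrand (X (n + N)) x) \<longlonglongrightarrow> log_log_integrand 0 x" if "x \<in> {0<..<1}" for x
      unfolding log_log_integrand_def using that XN
      by (intro tendsto_intros) (auto simp: add_pos_pos less_imp_neq[THEN not_sym])
    then show "AE x in lborel. (\<lambda>n. indicator {0<..<1} x *\<^sub>R log_log_integrand (X (n + N)) x)
        \<longlonglongrightarrow> indicator {0<..<1} x *\<^sub>R log_log_integrand 0 x"
      by (intro AE_I2) (auto split: split_indicator)
    show "AE x in lborel. norm (indicator {0<..<1} x *\<^sub>R log_log_integrand (X (n + N)) x)
        \<le> 2 * norm (indicator {0<..<1} x *\<^sub>R log_log_integrand (pi / 2) x)" for n
    proof (intro AE_I2)
      fix x :: real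
      have "norm (log_log_integrand (X (n + N)) x) \<le> 2 * norm (log_log_integrand (pi / 2) x)" if x: "x \<in> {0<..<1}"
      proof -
        have cos: "0 < cos (X (n + N))" using N[of "n + N"] by (intro cos_gt_zero_pi) auto
        define D where "D = 1 + 2 * x * cos (X (n + N)) + x\<^sup>2"
        have D: "1 \<le> D" using x cos by (simp add: D_def)
        have x2: "x\<^sup>2 \<le> 1" using x by (simp add: power_le_one)
        have "1 / D \<le> 1" using D by simp
        also have "1 \<le> 2 * (1 / (1 + x\<^sup>2))"
          using x2 by (simp add: divide_simps add_pos_nonneg)
        finally have "\<bar>ln (- ln x)\<bar> * (1 / D) \<le> \<bar>ln (- ln x)\<bar> * (2 * (1 / (1 + x\<^sup>2)))"
          by (rule mult_left_mono) simp
        also have "\<dots> = 2 * (\<bar>ln (- ln x)\<bar> * (1 / (1 + x\<^sup>2)))"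
          by simp
        finally have "\<bar>ln (- ln x)\<bar> * (1 / D) \<le> 2 * (\<bar>ln (- ln x)\<bar> * (1 / (1 + x\<^sup>2)))" .
        moreover have "\<bar>D\<bar> = D" "\<bar>1 + x\<^sup>2\<bar> = 1 + x\<^sup>2" using D by (auto simp: add_nonneg_nonneg)
        ultimately show ?thesis by (simp add: log_log_integrand_def abs_mult abs_divide flip: D_def)
      qed
      then show "norm (indicator {0<..<1} x *\<^sub>R log_log_integrand (X (n + N)) x)
          \<le> 2 * norm (indicator {0<..<1} x *\<^sub>R log_log_integrand (pi / 2) x)"
        by (simp split: split_indicator)
    qed
  qed (simp_all add: log_log_integrand_def)
  then show "(\<lambda>n. LBINT x:{0<..<1}. log_log_integrand (X n) x) \<longlonglongrightarrow> (LBINT x:{0<..<1}. log_log_integrand 0 x)"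
    by (rule LIMSEQ_offset)
qed

theorem proposition3:
  fixes t :: real
  assumes "t \<in> {-pi<..<pi}"
  shows "set_integrable lborel {0<..<1} (log_log_integrand t) \<and>
    (t \<noteq> 0 \<longrightarrow> (LBINT x:{0<..<1}. log_log_integrand t x) = log_log_closed_form t) \<and>
    (t = 0 \<longrightarrow> (log_log_closed_form \<longlongrightarrow> (LBINT x:{0<..<1}. log_log_integrand t x)) (at 0))"
proof (intro conjI impI)
  have t: "\<bar>t\<bar> < pi" using assms by auto
  then show "set_integrable lborel {0<..<1} (log_log_integrand t)"
    by (rule set_integrable_log_log_integrand)
  show "(LBINT x:{0<..<1}. log_log_integrand t x) = log_log_closed_form t" if "t \<noteq> 0"
    using t that by (rule integral_eq_log_log_closed_form)
  \<comment> \<open>On this punctured ball the closed form equals the integral, so it inherits the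
    limit; its default value at 0 does not enter.\<close>
  have "eventually (\<lambda>t :: real. t \<in> ball 0 pi \<and> t \<noteq> 0 \<and> t \<in> UNIV) (at 0)"
    by (rule eventually_at_ball') simp
  then have "eventually (\<lambda>t. (LBINT x:{0<..<1}. log_log_integrand t x) = log_log_closed_form t) (at 0)"
    by (rule eventually_mono) (intro integral_eq_log_log_closed_form, simp_all add: dist_real_def)
  with tendsto_integral_log_log_integrand
  show "(log_log_closed_form \<longlongrightarrow> (LBINT x:{0<..<1}. log_log_integrand t x)) (at 0)" if "t = 0"
    unfolding that by (rule Lim_transform_eventually)
qed

end
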